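(* Let $k\geq 1$ be an integer and let $G$ be an edge-colored complete graph on $n$ vertices satisfying $\Delta^{mon}(G)\leq n-2k$. Then either $G$ contains $k$ pairwise vertex-disjoint properly colored cycles of length at most $4$, or each vertex of $G$ with color degree at most $3$ is contained in a properly colored cycle of length $3$ or $4$.
   Context: All graphs are finite and simple. An edge-colored graph is a graph with an arbitrary mapping $col:E(G)\to\mathbb{N}$ (not necessarily a proper coloring). For a color $i$, $G^i$ is the spanning subgraph of $G$ formed by the edges of color $i$, and $\Delta^{mon}(G)=\max_i \Delta(G^i)$ (maximum over the colors $i$ appearing in $G$) is the maximum monochromatic degree. The color degree of a vertex $v$ is the number of different colors appearing on the edges incident with $v$. A cycle is properly colored (PC) if any two adjacent edges of the cycle have distinct colors. "Either ... or" is inclusive. *)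

theory Defs
  imports "HOL-Library.Disjoint_Sets"
begin

text \<open>
  A graph is given by its vertex set \<open>V\<close> and its set \<open>E\<close> of two-element edges. An edge-coloring is
  a total function on sets of vertices, of which only the values on \<open>E\<close> matter.
\<close>

definition simple_graph :: "'a set \<Rightarrow> 'a set set \<Rightarrow> bool" where
  "simple_graph V E \<longleftrightarrow> finite V \<and> (\<forall>e\<in>E. e \<subseteq> V \<and> card e = 2)"

definition complete_graph :: "'a set \<Rightarrow> 'a set set \<Rightarrow> bool" where
  "complete_graph V E \<longleftrightarrow> simple_graph V E \<and> (\<forall>u\<in>V. \<forall>v\<in>V. u \<noteq> v \<longrightarrow> {u, v} \<in> E)"

definition incident_edges :: "'a set set \<Rightarrow> 'a \<Rightarrow> 'a set set" where
  "incident_edges E v = {e \<in> E. v \<in> e}"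

definition degree :: "'a set set \<Rightarrow> 'a \<Rightarrow> nat" where
  "degree E v = card (incident_edges E v)"

text \<open>The inserted \<open>0\<close> only fixes the value of a maximum over the empty set, here and below.\<close>

definition max_degree :: "'a set \<Rightarrow> 'a set set \<Rightarrow> nat" where
  "max_degree V E = Max (insert 0 (degree E ` V))"

definition color_class :: "'a set set \<Rightarrow> ('a set \<Rightarrow> nat) \<Rightarrow> nat \<Rightarrow> 'a set set" where
  "color_class E col i = {e \<in> E. col e = i}"

definition max_mon_degree :: "'a set \<Rightarrow> 'a set set \<Rightarrow> ('a set \<Rightarrow> nat) \<Rightarrow> nat" where
  "max_mon_degree V E col =
     Max (insert 0 ((\<lambda>i. max_degree V (color_class E col i)) ` (col ` E)))"

definition color_degree :: "'a set set \<Rightarrow> ('a set \<Rightarrow> nat) \<Rightarrow> 'a \<Rightarrow> nat" where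
  "color_degree E col v = card (col ` incident_edges E v)"

text \<open>A cycle is represented by the list of its vertices in cyclic order.\<close>

definition cycle_edges :: "'a list \<Rightarrow> 'a set set" where
  "cycle_edges c = {{c ! i, c ! (Suc i mod length c)} | i. i < length c}"

definition is_cycle :: "'a set \<Rightarrow> 'a set set \<Rightarrow> 'a list \<Rightarrow> bool" where
  "is_cycle V E c \<longleftrightarrow>
     3 \<le> length c \<and> distinct c \<and> set c \<subseteq> V \<and> cycle_edges c \<subseteq> E"

definition pc_cycle :: "'a set \<Rightarrow> 'a set set \<Rightarrow> ('a set \<Rightarrow> nat) \<Rightarrow> 'a list \<Rightarrow> bool" where
  "pc_cycle V E col c \<longleftrightarrow> is_cycle V E c \<and>
     (\<forall>e\<in>cycle_edges c. \<forall>f\<in>cycle_edges c. e \<noteq> f \<and> e \<inter> f \<noteq> {} \<longrightarrow> col e \<noteq> col f)"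

end

theory Submission
  imports Defs
begin

text \<open>
  Let \<open>v\<close> have color degree at most \<open>3\<close> and lie on no properly colored cycle of length \<open>3\<close> or \<open>4\<close>,
  and put \<open>f u = col {v, u}\<close>. Then an edge \<open>u w\<close> with \<open>f u \<noteq> f w\<close> has color \<open>f u\<close> or \<open>f w\<close>; direct it
  towards \<open>w\<close> in the latter case. This is a tournament with at most three parts, the classes of \<open>f\<close>,
  and its directed cycles are properly colored. Vertices on an edge inside a class \<open>i\<close> with color
  other than \<open>i\<close> are beaten by no vertex outside their class, so they can be dropped; all
  remaining out-degrees are then at least \<open>2k - 1\<close>.

  Such a tournament has \<open>k\<close> disjoint cycles of length at most \<open>4\<close>, by induction on \<open>k\<close>. Restrict to
  a minimal out-closed set, which is strongly connected. If it contains a triangle, every vertex is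
  adjacent to exactly two vertices of it. Otherwise no path \<open>p \<rightarrow> q \<rightarrow> r\<close> meets three parts, because
  a shortest way back from \<open>r\<close> to \<open>p\<close> would produce a triangle; so only two parts are left. Then there
  is a \<open>4\<close>-cycle, and again every vertex is adjacent to exactly two vertices of that cycle. So
  removing the cycle costs every vertex at most two out-neighbors.
\<close>

section \<open>Multipartite tournaments\<close>

locale multipartite_tournament =
  fixes S :: "'a set" and f :: "'a \<Rightarrow> 'c" and R :: "'a \<Rightarrow> 'a \<Rightarrow> bool"
  assumes finite_verts: "finite S"
    and arc_parts: "\<lbrakk>x \<in> S; y \<in> S; R x y\<rbrakk> \<Longrightarrow> f x \<noteq> f y"
    and arc_total: "\<lbrakk>x \<in> S; y \<in> S; f x \<noteq> f y\<rbrakk> \<Longrightarrow> R x y \<or> R y x"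
    and arc_asym: "\<lbrakk>x \<in> S; y \<in> S; R x y\<rbrakk> \<Longrightarrow> \<not> R y x"

lemma multipartite_tournament_subset:
  assumes "multipartite_tournament S f R" "T \<subseteq> S"
  shows "multipartite_tournament T f R"
proof -
  interpret multipartite_tournament S f R by fact
  show ?thesis
    using assms(2) finite_verts
    by unfold_locales
      (simp_all add: finite_subset subset_iff arc_parts arc_total arc_asym)
qed

section \<open>Short directed cycles and out-closed sets\<close>

definition short_dicycle :: "('a \<Rightarrow> 'a \<Rightarrow> bool) \<Rightarrow> 'a list \<Rightarrow> bool" where
  "short_dicycle R c \<longleftrightarrow> distinct c \<and>
     ((\<exists>x y z. c = [x, y, z] \<and> R x y \<and> R y z \<and> R z x) \<or>
      (\<exists>x y z w. c = [x, y, z, w] \<and> R x y \<and> R y z \<and> R z w \<and> R w x))"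

text \<open>A minimal nonempty out-closed set is a terminal strong component. Closure is relative to
  \<open>S\<close> because \<open>R\<close> lives on the whole type.\<close>

definition out_closed :: "('a \<Rightarrow> 'a \<Rightarrow> bool) \<Rightarrow> 'a set \<Rightarrow> 'a set \<Rightarrow> bool" where
  "out_closed R S T \<longleftrightarrow> T \<subseteq> S \<and> (\<forall>x\<in>T. \<forall>y\<in>S. R x y \<longrightarrow> y \<in> T)"

lemma ex_minimal_out_closed:
  assumes "finite S" "S \<noteq> {}"
  obtains T where "T \<noteq> {}" "out_closed R S T"
    "\<forall>U. U \<noteq> {} \<longrightarrow> out_closed R T U \<longrightarrow> U = T"
proof -
  let ?F = "{T. T \<noteq> {} \<and> out_closed R S T}"
  have "finite ?F"
    by (rule finite_subset[of _ "Pow S"]) (use assms in \<open>auto simp: out_closed_def\<close>)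
  moreover have "S \<in> ?F"
    using assms by (auto simp: out_closed_def)
  ultimately obtain T where T: "T \<in> ?F" "\<And>U. U \<in> ?F \<Longrightarrow> U \<subseteq> T \<Longrightarrow> U = T"
    by (metis (no_types, lifting) finite_has_minimal2)
  show thesis
  proof (rule that[of T])
    show "\<forall>U. U \<noteq> {} \<longrightarrow> out_closed R T U \<longrightarrow> U = T"
    proof (intro allI impI)
      fix U assume U: "U \<noteq> {}" "out_closed R T U"
      \<comment> \<open>Out-closedness is transitive, so minimality among out-closed subsets of
        \<open>S\<close> becomes a property of \<open>T\<close> alone.\<close>
      have "out_closed R S U"
        using T(1) U(2) unfolding out_closed_def by blast
      then show "U = T"
        using T(2)[of U] U by (auto simp: out_closed_def)
    qed
  qed (use T in auto)
qed

section \<open>Tournaments without directed triangles\<close>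

locale triangle_free_tournament = multipartite_tournament +
  fixes F
  assumes three_parts: "finite F" "card F \<le> 3" "f ` S \<subseteq> F"
    and triangle_free: "\<lbrakk>x \<in> S; y \<in> S; z \<in> S; R x y; R y z\<rbrakk> \<Longrightarrow> \<not> R z x"
begin

lemma part_cases:
  assumes "p \<in> S" "q \<in> S" "r \<in> S" "x \<in> S" "f p \<noteq> f q" "f q \<noteq> f r" "f p \<noteq> f r"
  shows "f x = f p \<or> f x = f q \<or> f x = f r"
proof -
  have "card {f p, f q, f r} = 3"
    using assms by simp
  then have "{f p, f q, f r} = F"
    using three_parts assms by (intro card_seteq) auto
  then show ?thesis
    using three_parts assms(4) by auto
qed

lemma arc_trans:
  assumes "x \<in> S" "y \<in> S" "z \<in> S" "R x y" "R y z" "f x \<noteq> f z"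
  shows "R x z"
  using assms arc_total triangle_free by blast

text \<open>Induction on the length of a walk from \<open>r\<close> back to \<open>p\<close>: its
  first one or two steps either shorten the walk or yield another path through three parts with a
  shorter return.\<close>

lemma no_return:
  assumes "p \<in> S" "q \<in> S" "r \<in> S" "R p q" "R q r" "f p \<noteq> f r"
  shows "(r, p) \<notin> {(x, y). x \<in> S \<and> y \<in> S \<and> R x y} ^^ m"
  using assms
proof (induction m arbitrary: p q r rule: less_induct)
  case (less m)
  let ?A = "{(x, y). x \<in> S \<and> y \<in> S \<and> R x y}"
  note S = less.prems(1-3)
  have parts: "f p \<noteq> f q" "f q \<noteq> f r" "f p \<noteq> f r"
    using less.prems arc_parts by blast+
  have pr: "R p r"
    using arc_trans less.prems by blast
  show ?case
  proof
    assume path: "(r, p) \<in> ?A ^^ m"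
    have "m \<noteq> 0"
      using path parts by (cases m) auto
    then obtain m' where m: "m = Suc m'"
      by (cases m) auto
    obtain y where y: "y \<in> S" "R r y" "(y, p) \<in> ?A ^^ m'"
      using relpow_Suc_D2[OF path[unfolded m]] by auto
    have "f y \<noteq> f r"
      using arc_parts[OF S(3) y(1,2)] by simp
    then consider "f y = f q" | "f y = f p"
      using part_cases[OF S y(1) parts] by blast
    then show False
    proof cases
      case 1
      \<comment> \<open>The path \<open>p\<close>, \<open>r\<close>, \<open>y\<close> meets three
        parts and has a shorter return.\<close>
      then show False
        using less.IH[of m' p r y] S y pr parts m by auto
    next
      case 2
      \<comment> \<open>As \<open>p\<close> beats \<open>q\<close>, this arc excludes
        \<open>y = p\<close>, so the walk has a second step.\<close>
      have qy: "R q y"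
        using arc_trans[OF S(2,3) y(1)] less.prems(5) y(2) 2 parts by simp
      have "y \<noteq> p"
        using qy less.prems arc_asym by blast
      then have "m' \<noteq> 0"
        using y(3) by (cases m') auto
      then obtain m'' where m': "m' = Suc m''"
        by (cases m') auto
      obtain z where z: "z \<in> S" "R y z" "(z, p) \<in> ?A ^^ m''"
        using relpow_Suc_D2[OF y(3)[unfolded m']] by auto
      have "f z \<noteq> f p"
        using arc_parts[OF y(1) z(1,2)] 2 by simp
      then consider "f z = f q" | "f z = f r"
        using part_cases[OF S z(1) parts] by blast
      then show False
      proof cases
        case 1
        \<comment> \<open>The walk can skip \<open>y\<close>.\<close>
        have "R r z"
          using arc_trans[OF S(3) y(1) z(1) y(2) z(2)] 1 parts by simp
        then have "(r, p) \<in> ?A ^^ m'"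
          unfolding m' using z S by (intro relpow_Suc_I2[of _ z]) auto
        then show False
          using less.IH[of m' p q r] less.prems m by auto
      next
        case 2
        \<comment> \<open>Here \<open>z\<close> takes the place of \<open>r\<close>, which saves two
          steps.\<close>
        have "R q z"
          using arc_trans[OF S(2) y(1) z(1) qy z(2)] 2 parts by simp
        then show False
          using less.IH[of m'' p q z] less.prems z m m' 2 by auto
      qed
    qed
  qed
qed

text \<open>Minimality gives strong connectivity, so by \<open>no_return\<close> two consecutive
  arcs end in the part where they start. Hence the heads of arcs between two parts joined by some
  arc form an out-closed set, which is all of \<open>S\<close>.\<close>

lemma minimal_two_parts:
  assumes S: "S \<noteq> {}" and out: "\<And>x. x \<in> S \<Longrightarrow> \<exists>y\<in>S. R x y"
    and min: "\<And>U. U \<noteq> {} \<Longrightarrow> out_closed R S U \<Longrightarrow> U = S"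
  obtains i j where "f ` S \<subseteq> {i, j}"
proof -
  let ?A = "{(x, y). x \<in> S \<and> y \<in> S \<and> R x y}"
  have strong: "(r, p) \<in> ?A\<^sup>*" if "r \<in> S" "p \<in> S" for r p
  proof -
    let ?U = "{p \<in> S. (r, p) \<in> ?A\<^sup>*}"
    have "out_closed R S ?U"
      by (auto simp: out_closed_def intro: rtrancl_into_rtrancl)
    moreover have "?U \<noteq> {}"
      using that by auto
    ultimately have "?U = S"
      by (intro min)
    then have "p \<in> ?U"
      using that by simp
    then show ?thesis
      by simp
  qed
  have same: "f p = f r" if "p \<in> S" "q \<in> S" "r \<in> S" "R p q" "R q r" for p q r
    using no_return[OF that] strong[OF that(3,1)] rtrancl_power by blast
  obtain a b where ab: "a \<in> S" "b \<in> S" "R a b"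
    using S out by blast
  let ?P = "\<lambda>i j x. f x = j \<and> (\<exists>p\<in>S. f p = i \<and> R p x)"
  let ?U = "{x \<in> S. ?P (f a) (f b) x \<or> ?P (f b) (f a) x}"
  have "out_closed R S ?U"
    unfolding out_closed_def
  proof (intro conjI ballI impI)
    fix x y assume x: "x \<in> ?U" and y: "y \<in> S" "R x y"
    have "x \<in> S" using x by simp
    then have "\<exists>p\<in>S. f p = f x \<and> R p y" using y by blast
    moreover have "f y = f a" if "f x = f b" "p \<in> S" "f p = f a" "R p x" for p
      using same[of p x y] that \<open>x \<in> S\<close> y by simp
    moreover have "f y = f b" if "f x = f a" "p \<in> S" "f p = f b" "R p x" for p
      using same[of p x y] that \<open>x \<in> S\<close> y by simp
    ultimately show "y \<in> ?U" using x y(1) by auto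
  qed simp
  moreover have "?U \<noteq> {}"
    using ab by blast
  ultimately have "?U = S"
    by (intro min)
  then have "f ` S \<subseteq> {f a, f b}"
    by blast
  then show thesis
    by (rule that)
qed

end

section \<open>Finding and removing short cycles\<close>

text \<open>Take \<open>a\<close> of least out-degree and a path from \<open>a\<close> over
  \<open>b\<close> to \<open>c\<close>. Since \<open>b\<close> is an out-neighbor of
  \<open>a\<close> but not of \<open>c\<close>, some out-neighbor \<open>d\<close> of
  \<open>c\<close> is not one of \<open>a\<close>; it lies opposite to \<open>a\<close>, so it beats
  \<open>a\<close>.\<close>

lemma (in multipartite_tournament) bipartite_four_cycle:
  assumes S: "S \<noteq> {}" and out: "\<And>x. x \<in> S \<Longrightarrow> \<exists>y\<in>S. R x y"
    and ij: "f ` S \<subseteq> {i, j}"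
  obtains a b c d where "{a, b, c, d} \<subseteq> S" "distinct [a, b, c, d]"
    "R a b" "R b c" "R c d" "R d a"
proof -
  let ?N = "\<lambda>x. {y \<in> S. R x y}"
  obtain a where a: "a \<in> S" "\<And>x. x \<in> S \<Longrightarrow> card (?N a) \<le> card (?N x)"
    using S ex_has_least_nat[of "\<lambda>x. x \<in> S" _ "\<lambda>x. card (?N x)"] by blast
  obtain b where b: "b \<in> S" "R a b" using out a by blast
  obtain c where c: "c \<in> S" "R b c" using out b by blast
  have ac: "f a = f c" and ab: "f a \<noteq> f b"
    using arc_parts[OF a(1) b] arc_parts[OF b(1) c] a(1) b(1) c(1) ij by auto
  have "\<not> ?N c \<subseteq> ?N a"
  proof
    assume "?N c \<subseteq> ?N a"
    moreover have "b \<in> ?N a" "b \<notin> ?N c"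
      using b c arc_asym by auto
    ultimately have "card (?N c) < card (?N a)"
      using finite_verts by (intro psubset_card_mono) auto
    then show False
      using a(2)[OF c(1)] by simp
  qed
  then obtain d where d: "d \<in> S" "R c d" "\<not> R a d"
    by blast
  have "f d \<noteq> f a"
    using arc_parts[OF c(1) d(1,2)] ac by simp
  then have da: "R d a"
    using arc_total[OF d(1) a(1)] d(3) by blast
  have "distinct [a, b, c, d]"
    using arc_asym[OF a(1) b] arc_asym[OF b(1) c] ab ac \<open>f d \<noteq> f a\<close> b(2) c(2) d(2,3) by auto
  then show thesis
    using that[of a b c d] a b c d da by blast
qed

lemma minimal_cycle:
  assumes mt: "multipartite_tournament S f R"
    and F: "finite F" "card F \<le> 3" "f ` S \<subseteq> F"
    and S: "S \<noteq> {}" and out: "\<And>x. x \<in> S \<Longrightarrow> \<exists>y\<in>S. R x y"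
    and min: "\<And>U. U \<noteq> {} \<Longrightarrow> out_closed R S U \<Longrightarrow> U = S"
  obtains c where "short_dicycle R c" "set c \<subseteq> S"
    "\<forall>x\<in>S. card {y \<in> set c. R x y} \<le> 2"
proof -
  interpret multipartite_tournament S f R by fact
  have two: "card {y \<in> C. R x y} \<le> 2" if "{y \<in> C. R x y} \<subseteq> {a, b}" for C x and a b :: 'a
  proof -
    have "card {y \<in> C. R x y} \<le> card {a, b}"
      using that by (intro card_mono) auto
    also have "\<dots> \<le> 2"
      by (simp add: card_insert_if)
    finally show ?thesis .
  qed
  show thesis
  proof (cases "\<exists>x\<in>S. \<exists>y\<in>S. \<exists>z\<in>S. R x y \<and> R y z \<and> R z x")
    case True
    then obtain x y z where xyz: "x \<in> S" "y \<in> S" "z \<in> S" "R x y" "R y z" "R z x"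
      by blast
    have parts: "f x \<noteq> f y" "f y \<noteq> f z" "f z \<noteq> f x"
      using xyz arc_parts by blast+
    have "card {f x, f y, f z} = 3"
      using parts by simp
    then have eq: "{f x, f y, f z} = F"
      using F xyz by (intro card_seteq) auto
    have "short_dicycle R [x, y, z]"
      using xyz parts by (auto simp: short_dicycle_def)
    \<comment> \<open>The triangle meets every part, so \<open>w\<close> shares its part with one of
      the three vertices.\<close>
    moreover have "card {y' \<in> set [x, y, z]. R w y'} \<le> 2" if w: "w \<in> S" for w
    proof -
      consider "f w = f x" | "f w = f y" | "f w = f z"
        using w F(3) eq by blast
      then show ?thesis
      proof cases
        case 1
        then have "\<not> R w x" using arc_parts w xyz by blast
        then show ?thesis by (intro two[of _ _ y z]) auto
      next
        case 2
        then have "\<not> R w y" using arc_parts w xyz by blast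
        then show ?thesis by (intro two[of _ _ x z]) auto
      next
        case 3
        then have "\<not> R w z" using arc_parts w xyz by blast
        then show ?thesis by (intro two[of _ _ x y]) auto
      qed
    qed
    ultimately show thesis
      using that[of "[x, y, z]"] xyz by simp
  next
    case False
    interpret triangle_free_tournament S f R F
    proof
      fix x y z assume "x \<in> S" "y \<in> S" "z \<in> S" "R x y" "R y z"
      then show "\<not> R z x"
        using False by blast
    qed (fact F)+
    obtain i j where ij: "f ` S \<subseteq> {i, j}"
      by (rule minimal_two_parts[OF S out min])
    obtain a b c d where abcd: "{a, b, c, d} \<subseteq> S" "distinct [a, b, c, d]"
      "R a b" "R b c" "R c d" "R d a"
      by (rule bipartite_four_cycle[OF S out ij])
    have ne: "f a \<noteq> f b" "f b \<noteq> f c" "f c \<noteq> f d"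
      using abcd arc_parts by auto
    have "card {y \<in> set [a, b, c, d]. R w y} \<le> 2" if w: "w \<in> S" for w
    proof -
      have eq: "f x = f z" if "x \<in> S" "y \<in> S" "z \<in> S" "f x \<noteq> f y" "f y \<noteq> f z" for x y z
        using ij that by blast
      have "f a = f c" "f b = f d"
        using eq[of a b c] eq[of b c d] ne abcd(1) by simp_all
      moreover have "f w = f a" if "f w \<noteq> f b"
        using eq[of w b a] ne(1) w abcd(1) that by simp
      ultimately consider "f w = f a" "f w = f c" | "f w = f b" "f w = f d"
        by metis
      then show ?thesis
      proof cases
        case 1
        then have "\<not> R w a" "\<not> R w c"
          using arc_parts[OF w, of a] arc_parts[OF w, of c] abcd(1) by auto
        then show ?thesis by (intro two[of _ _ b d]) auto
      next
        case 2
        then have "\<not> R w b" "\<not> R w d"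
          using arc_parts[OF w, of b] arc_parts[OF w, of d] abcd(1) by auto
        then show ?thesis by (intro two[of _ _ a c]) auto
      qed
    qed
    moreover have "short_dicycle R [a, b, c, d]"
      using abcd by (auto simp: short_dicycle_def)
    ultimately show thesis
      using that[of "[a, b, c, d]"] abcd(1) by simp
  qed
qed

text \<open>The \<open>+ 1\<close> expresses out-degree at least \<open>2 * k - 1\<close> without
  truncated subtraction. An out-closed set keeps all out-degrees, and removing a cycle lowers each
  by at most two, just as \<open>2 * k\<close> drops by two.\<close>

theorem disjoint_short_dicycles:
  assumes "multipartite_tournament S f R"
    and "finite F" "card F \<le> 3" "f ` S \<subseteq> F" "S \<noteq> {}"
    and "\<And>x. x \<in> S \<Longrightarrow> 2 * k \<le> card {y \<in> S. R x y} + 1"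
  shows "\<exists>C :: nat \<Rightarrow> 'a list. (\<forall>i<k. short_dicycle R (C i) \<and> set (C i) \<subseteq> S) \<and>
           disjoint_family_on (\<lambda>i. set (C i)) {..<k}"
  using assms
proof (induction k arbitrary: S)
  case 0
  then show ?case by (simp add: disjoint_family_on_def)
next
  case (Suc k)
  interpret multipartite_tournament S f R by fact
  obtain T where T: "T \<noteq> {}" "out_closed R S T"
    and min: "\<forall>U. U \<noteq> {} \<longrightarrow> out_closed R T U \<longrightarrow> U = T"
    by (rule ex_minimal_out_closed[OF finite_verts Suc.prems(5)])
  have TS: "T \<subseteq> S" and finT: "finite T"
    using T(2) finite_verts by (auto simp: out_closed_def intro: finite_subset)
  have deg: "2 * k + 1 \<le> card {y \<in> T. R x y}" if "x \<in> T" for x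
  proof -
    have "{y \<in> S. R x y} = {y \<in> T. R x y}"
      using T(2) that by (auto simp: out_closed_def)
    then show ?thesis
      using Suc.prems(6)[of x] that TS by auto
  qed
  have out: "\<exists>y\<in>T. R x y" if "x \<in> T" for x
  proof -
    have "{y \<in> T. R x y} \<noteq> {}"
      using deg[OF that] by (intro notI) simp
    then show ?thesis by blast
  qed
  have FT: "f ` T \<subseteq> F"
    using Suc.prems(4) TS by blast
  obtain c where c: "short_dicycle R c" "set c \<subseteq> T"
    "\<forall>x\<in>T. card {y \<in> set c. R x y} \<le> 2"
    by (rule minimal_cycle[OF multipartite_tournament_subset[OF Suc.prems(1) TS] Suc.prems(2,3)
        FT T(1) out min[rule_format]])
  let ?S = "T - set c"
  \<comment> \<open>Vertices of the cycle are included, so any vertex of \<open>T\<close> can later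
    witness that \<open>?S\<close> is nonempty.\<close>
  have deg': "2 * k \<le> card {y \<in> ?S. R x y} + 1" if x: "x \<in> T" for x
  proof -
    have "card {y \<in> T. R x y} = card ({y \<in> ?S. R x y} \<union> {y \<in> set c. R x y})"
      using c(2) by (intro arg_cong[of _ _ card]) auto
    also have "\<dots> \<le> card {y \<in> ?S. R x y} + card {y \<in> set c. R x y}"
      by (rule card_Un_le)
    finally show ?thesis
      using deg[OF x] bspec[OF c(3) x] by simp
  qed
  have "\<exists>C :: nat \<Rightarrow> 'a list. (\<forall>i<k. short_dicycle R (C i) \<and> set (C i) \<subseteq> ?S) \<and>
           disjoint_family_on (\<lambda>i. set (C i)) {..<k}"
  \<comment> \<open>For \<open>k = 0\<close> the cycle may exhaust \<open>T\<close>, and the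
    induction hypothesis asks for a nonempty set.\<close>
  proof (cases "k = 0")
    case True
    then show ?thesis by (simp add: disjoint_family_on_def)
  next
    case False
    obtain x where x: "x \<in> T" using T(1) by blast
    have "?S \<noteq> {}"
      using deg'[OF x] False by (intro notI) simp
    then show ?thesis
      using Suc.prems TS deg'
      by (intro Suc.IH multipartite_tournament_subset[OF Suc.prems(1)]) auto
  qed
  then obtain C where C: "\<And>i. i < k \<Longrightarrow> short_dicycle R (C i) \<and> set (C i) \<subseteq> ?S"
    "disjoint_family_on (\<lambda>i. set (C i)) {..<k}"
    by blast
  have "disjoint_family_on (\<lambda>i. set ((C(k := c)) i)) {..<Suc k}"
    using C unfolding disjoint_family_on_def by (fastforce simp: less_Suc_eq)
  moreover have "short_dicycle R ((C(k := c)) i) \<and> set ((C(k := c)) i) \<subseteq> S" if "i < Suc k" for i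
    using that C(1)[of i] c(1,2) TS by (auto simp: less_Suc_eq)
  ultimately show ?case
    by (intro exI[of _ "C(k := c)"]) simp
qed

section \<open>Colored complete graphs\<close>

lemma complete_graph_edge:
  assumes "complete_graph V E" "x \<in> V" "y \<in> V" "x \<noteq> y"
  shows "{x, y} \<in> E"
  using assms by (simp add: complete_graph_def)

lemma cycle_edges_3: "cycle_edges [x, y, z] = {{x, y}, {y, z}, {z, x}}"
proof -
  have "{i. i < length [x, y, z]} = {0, 1, 2}" by auto
  then show ?thesis
    unfolding cycle_edges_def setcompr_eq_image by simp
qed

lemma cycle_edges_4: "cycle_edges [x, y, z, w] = {{x, y}, {y, z}, {z, w}, {w, x}}"
proof -
  have "{i. i < length [x, y, z, w]} = {0, 1, 2, 3}" by auto
  then show ?thesis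
    unfolding cycle_edges_def setcompr_eq_image by simp
qed

lemma pc_cycle_3:
  assumes "complete_graph V E" "{x, y, z} \<subseteq> V" "distinct [x, y, z]"
    and "col {x, y} \<noteq> col {y, z}" "col {y, z} \<noteq> col {z, x}" "col {z, x} \<noteq> col {x, y}"
  shows "pc_cycle V E col [x, y, z]"
  using assms unfolding pc_cycle_def is_cycle_def cycle_edges_3
  by (auto simp: complete_graph_edge)

lemma pc_cycle_4:
  assumes "complete_graph V E" "{x, y, z, w} \<subseteq> V" "distinct [x, y, z, w]"
    and "col {x, y} \<noteq> col {y, z}" "col {y, z} \<noteq> col {z, w}"
    and "col {z, w} \<noteq> col {w, x}" "col {w, x} \<noteq> col {x, y}"
  shows "pc_cycle V E col [x, y, z, w]"
  using assms unfolding pc_cycle_def is_cycle_def cycle_edges_4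
  by (auto simp: complete_graph_edge)

lemma card_color_neighbors_le:
  assumes G: "complete_graph V E" and x: "x \<in> V"
  shows "card {w \<in> V - {x}. col {x, w} = i} \<le> max_mon_degree V E col"
\<comment> \<open>Only colors occurring on \<open>E\<close> enter the maximum, so a color absent at
  \<open>x\<close> is treated apart.\<close>
proof (cases "{w \<in> V - {x}. col {x, w} = i} = {}")
  case False
  let ?N = "{w \<in> V - {x}. col {x, w} = i}"
  have fin: "finite V" "finite E"
    using G finite_subset[of E "Pow V"] by (auto simp: complete_graph_def simple_graph_def)
  have i: "i \<in> col ` E"
    using False complete_graph_edge[OF G x] by blast
  have "inj_on (\<lambda>w. {x, w}) ?N"
    by (auto simp: inj_on_def doubleton_eq_iff)
  moreover have "(\<lambda>w. {x, w}) ` ?N \<subseteq> incident_edges (color_class E col i) x"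
    using complete_graph_edge[OF G x] by (auto simp: incident_edges_def color_class_def)
  moreover have "finite (incident_edges (color_class E col i) x)"
    using fin by (simp add: incident_edges_def color_class_def)
  ultimately have "card ?N \<le> degree (color_class E col i) x"
    unfolding degree_def by (rule card_inj_on_le)
  also have "\<dots> \<le> max_degree V (color_class E col i)"
    unfolding max_degree_def using fin x by (intro Max_ge) auto
  also have "\<dots> \<le> max_mon_degree V E col"
    unfolding max_mon_degree_def using fin i by (intro Max_ge) auto
  finally show ?thesis .
qed (simp only: card.empty)

section \<open>A vertex on no short properly colored cycle\<close>

locale uncovered_vertex =
  fixes V :: "'a set" and E :: "'a set set" and col :: "'a set \<Rightarrow> nat" and v :: 'a
  assumes complete: "complete_graph V E" and v: "v \<in> V"
    and uncovered: "\<And>c. pc_cycle V E col c \<Longrightarrow> v \<in> set c \<Longrightarrow> length c \<notin> {3, 4}"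
begin

definition part :: "'a \<Rightarrow> nat" where
  "part u = col {v, u}"

definition arc :: "'a \<Rightarrow> 'a \<Rightarrow> bool" where
  "arc u w \<longleftrightarrow> part u \<noteq> part w \<and> col {u, w} = part w"

definition impure :: "'a set" where
  "impure = {u \<in> V - {v}. \<exists>x \<in> V - {v}. x \<noteq> u \<and> part x = part u \<and> col {u, x} \<noteq> part u}"

text \<open>Otherwise \<open>v\<close>, \<open>u\<close>, \<open>w\<close> form a properly colored
  triangle.\<close>

lemma cross_color:
  assumes "u \<in> V - {v}" "w \<in> V - {v}" "part u \<noteq> part w"
  shows "col {u, w} = part u \<or> col {u, w} = part w"
proof (rule ccontr)
  assume "\<not> ?thesis"
  then have "pc_cycle V E col [v, u, w]"
    using assms v complete by (intro pc_cycle_3) (auto simp: part_def insert_commute)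
  then show False
    using uncovered by fastforce
qed

text \<open>If \<open>w u\<close> had color \<open>part w\<close>, a witness \<open>x\<close> of
  impurity would give the cycle \<open>v\<close>, \<open>x\<close>, \<open>w\<close>,
  \<open>u\<close>: its edges \<open>v x\<close> and \<open>w u\<close> have color
  \<open>part w\<close>, the other two do not.\<close>

lemma impure_color:
  assumes w: "w \<in> impure" and u: "u \<in> V - {v}" and ne: "part u \<noteq> part w"
  shows "col {w, u} = part u"
proof (rule ccontr)
  assume *: "col {w, u} \<noteq> part u"
  obtain x where x: "x \<in> V - {v}" "x \<noteq> w" "part x = part w" "col {w, x} \<noteq> part w"
    using w by (auto simp: impure_def)
  have wV: "w \<in> V - {v}"
    using w by (auto simp: impure_def)
  have "col {w, u} = part w"
    using cross_color[OF wV u] ne * by auto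
  then have "pc_cycle V E col [v, x, w, u]"
    using x wV u ne v complete by (intro pc_cycle_4) (auto simp: part_def insert_commute)
  then show False
    using uncovered by fastforce
qed

lemma multipartite_tournament_arc:
  "multipartite_tournament (V - {v} - impure) part arc"
proof
  show "finite (V - {v} - impure)"
    using complete by (simp add: complete_graph_def simple_graph_def)
qed (use cross_color in \<open>auto simp: arc_def insert_commute\<close>)

text \<open>Each edge has the color of the part of its head, and consecutive heads lie in different
  parts.\<close>

lemma short_dicycle_pc_cycle:
  assumes "short_dicycle arc c" "set c \<subseteq> V"
  shows "pc_cycle V E col c" "length c \<le> 4"
proof -
  consider x y z where "c = [x, y, z]" "arc x y" "arc y z" "arc z x"
    | x y z w where "c = [x, y, z, w]" "arc x y" "arc y z" "arc z w" "arc w x"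
    using assms(1) by (auto simp: short_dicycle_def)
  then have "pc_cycle V E col c \<and> length c \<le> 4"
  proof cases
    case 1
    then show ?thesis
      using assms pc_cycle_3[OF complete, of x y z col] by (auto simp: short_dicycle_def arc_def)
  next
    case 2
    then show ?thesis
      using assms pc_cycle_4[OF complete, of x y z w col] by (auto simp: short_dicycle_def arc_def)
  qed
  then show "pc_cycle V E col c" "length c \<le> 4" by auto
qed

text \<open>Every edge at \<open>u\<close> of color other than \<open>part u\<close> is an arc to a
  pure out-neighbor, and at most \<open>max_mon_degree V E col\<close> edges at \<open>u\<close>
  have color \<open>part u\<close>.\<close>

lemma out_degree:
  assumes "max_mon_degree V E col + 2 * k \<le> card V" and u: "u \<in> V - {v} - impure"
  shows "2 * k \<le> card {w \<in> V - {v} - impure. arc u w} + 1"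
proof -
  let ?N = "{w \<in> V - {u}. col {u, w} = part u}" and ?O = "{w \<in> V - {v} - impure. arc u w}"
  have fin: "finite V"
    using complete by (simp add: complete_graph_def simple_graph_def)
  have "w \<in> ?O" if w: "w \<in> V - {u}" "col {u, w} \<noteq> part u" for w
  proof -
    \<comment> \<open>The edge from \<open>u\<close> to \<open>v\<close> has color
      \<open>part u\<close> by definition, so \<open>v\<close> is counted in
      \<open>?N\<close>.\<close>
    have wv: "w \<noteq> v"
      using w by (auto simp: part_def insert_commute)
    then have ne: "part u \<noteq> part w"
      using u w by (auto simp: impure_def)
    then have "w \<notin> impure"
      using impure_color[of w u] u w(2) by (auto simp: insert_commute)
    moreover have "arc u w"
      using cross_color[of u w] u w wv ne by (auto simp: arc_def)
    ultimately show ?thesis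
      using w wv by auto
  qed
  then have "V - {u} \<subseteq> ?N \<union> ?O" by blast
  then have "card (V - {u}) \<le> card (?N \<union> ?O)"
    using fin by (intro card_mono) auto
  also have "\<dots> \<le> card ?N + card ?O"
    by (rule card_Un_le)
  finally have "card V \<le> card ?N + card ?O + 1"
    using u by simp
  then show ?thesis
    using assms(1) card_color_neighbors_le[OF complete, of u col "part u"] u by simp
qed

text \<open>An edge between two impure vertices of different parts would need the colors of both
  parts.\<close>

lemma pure_nonempty:
  assumes "max_mon_degree V E col + 2 \<le> card V"
  shows "V - {v} - impure \<noteq> {}"
proof
  assume empty: "V - {v} - impure = {}"
  \<comment> \<open>The edges at \<open>v\<close> are not all of one color, as there are
    \<open>card V - 1\<close> of them.\<close>
  have differs: "\<exists>w\<in>V - {v}. part w \<noteq> i" for i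
  proof (rule ccontr)
    assume "\<not> ?thesis"
    then have "{w \<in> V - {v}. col {v, w} = i} = V - {v}"
      by (auto simp: part_def)
    then have "card (V - {v}) \<le> max_mon_degree V E col"
      using card_color_neighbors_le[OF complete v, of col i] by simp
    then show False
      using assms v by simp
  qed
  obtain u where u: "u \<in> V - {v}" using differs by blast
  obtain w where w: "w \<in> V - {v}" "part w \<noteq> part u" using differs by blast
  have "u \<in> impure" "w \<in> impure"
    using empty u w by auto
  then have "col {u, w} = part w" "col {w, u} = part u"
    using impure_color u w by auto
  then show False
    using w(2) by (simp add: insert_commute)
qed

text \<open>Through this inclusion the color degree of \<open>v\<close> bounds the number of
  parts.\<close>

lemma part_image_subset: "part ` (V - {v} - impure) \<subseteq> col ` incident_edges E v"
  using complete_graph_edge[OF complete v] by (auto simp: part_def incident_edges_def)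

end

theorem theorem9:
  fixes V :: "'a set" and E :: "'a set set" and col :: "'a set \<Rightarrow> nat" and n k :: nat
  assumes "k \<ge> 1"
    and "complete_graph V E"
    and "card V = n"
    and "int (max_mon_degree V E col) \<le> int n - 2 * int k"
  shows "(\<exists>C :: nat \<Rightarrow> 'a list.
            (\<forall>i<k. pc_cycle V E col (C i) \<and> length (C i) \<le> 4) \<and>
            disjoint_family_on (\<lambda>i. set (C i)) {..<k})
       \<or> (\<forall>v\<in>V. color_degree E col v \<le> 3 \<longrightarrow>
            (\<exists>c. pc_cycle V E col c \<and> v \<in> set c \<and> (length c = 3 \<or> length c = 4)))"
proof (rule disjCI)
  assume "\<not> (\<forall>v\<in>V. color_degree E col v \<le> 3 \<longrightarrow>
            (\<exists>c. pc_cycle V E col c \<and> v \<in> set c \<and> (length c = 3 \<or> length c = 4)))"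
  then obtain v where v': "v \<in> V" "color_degree E col v \<le> 3"
    "\<And>c. pc_cycle V E col c \<Longrightarrow> v \<in> set c \<Longrightarrow> length c \<notin> {3, 4}"
    by blast
  interpret uncovered_vertex V E col v
    using assms(2) v' by unfold_locales
  let ?S = "V - {v} - impure" and ?F = "col ` incident_edges E v"
  \<comment> \<open>The integer hypothesis forces \<open>2 * k \<le> n\<close>; the additive form
    carries this over to natural numbers.\<close>
  have bound: "max_mon_degree V E col + 2 * k \<le> card V"
    using assms(3,4) by linarith
  have "finite E"
    using complete finite_subset[of E "Pow V"] by (auto simp: complete_graph_def simple_graph_def)
  then have F: "finite ?F" "card ?F \<le> 3"
    using v'(2) by (auto simp: incident_edges_def color_degree_def)
  have "?S \<noteq> {}"
    using pure_nonempty bound assms(1) by simp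
  then obtain C where "\<forall>i<k. short_dicycle arc (C i) \<and> set (C i) \<subseteq> ?S"
    "disjoint_family_on (\<lambda>i. set (C i)) {..<k}"
    using disjoint_short_dicycles[OF multipartite_tournament_arc F part_image_subset _
        out_degree[OF bound]] by blast
  then show "\<exists>C :: nat \<Rightarrow> 'a list.
            (\<forall>i<k. pc_cycle V E col (C i) \<and> length (C i) \<le> 4) \<and>
            disjoint_family_on (\<lambda>i. set (C i)) {..<k}"
    by (intro exI[of _ C]) (meson Diff_subset short_dicycle_pc_cycle subset_trans)
qed

end
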